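(* Let $v<0$. Suppose that $E e^{u\eta_1}<\infty$ for all $0\le u<\infty$ and that $$\int_1^\infty e^{uy-\phi(u)}u^{v-1}\,du<\infty\quad\text{for every } y\in D.$$ Suppose that there exists $\delta\in(0,1]$ such that $$E(\eta_1^-)^\delta<\infty .$$ Set $$W_v(y)=\int_0^\infty (e^{uy-\phi(u)}-1)u^{v-1}\,du,\quad y\in D.$$ If $v\in(-\delta,0)$, then the process $\lambda^{vn}W_v(X_n)$, $n=0,1,2,\dots$, is a martingale with respect to the filtration $\mathcal{F}_n=\sigma\{X_0,X_1,\dots,X_n\}$.
   Context: Let $\{\eta_n\}_{n\ge 1}$ be a sequence of independent identically distributed real random variables, and let $\lambda$ and $x$ be nonrandom real constants with $0<\lambda<1$. The AR(1) sequence $(X_n)_{n\ge 0}$ is defined by $X_0=x$ and $X_n=\lambda X_{n-1}+\eta_n$ for $n=1,2,\dots$. The set $D\subset\mathbb{R}$ denotes the domain (state space) of the process, i.e. the set of values taken by $X_n$, $n=0,1,2,\dots$ (so $x\in D$ and $X_n\in D$ almost surely for all $n$). The cumulant function of $\eta_1$ is $\psi(u)=\log E e^{u\eta_1}$, $0\le u<\infty$, and $\phi(u)=\sum_{k=0}^\infty\psi(\lambda^k u)$, $0\le u<\infty$ (this series converges to a finite value when $E e^{u\eta_1}<\infty$ for all $u\ge0$ and $E\log(1+|\eta_1|)<\infty$). Notation: $y^-=\max(-y,0)$. *)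

theory Defs
  imports "HOL-Probability.Probability"
begin

text \<open>The index set is \<open>{1..}\<close>: the value at index 0 is irrelevant.\<close>

definition iid_seq :: "'a measure \<Rightarrow> (nat \<Rightarrow> 'a \<Rightarrow> real) \<Rightarrow> bool" where
  "iid_seq M \<eta> \<longleftrightarrow>
     prob_space.indep_vars M (\<lambda>_. borel) \<eta> {1..} \<and>
     (\<forall>n\<ge>1. distr M borel (\<eta> n) = distr M borel (\<eta> 1))"

primrec AR1 :: "real \<Rightarrow> real \<Rightarrow> (nat \<Rightarrow> 'a \<Rightarrow> real) \<Rightarrow> nat \<Rightarrow> 'a \<Rightarrow> real" where
  "AR1 lam x \<eta> 0 \<omega> = x"
| "AR1 lam x \<eta> (Suc n) \<omega> = lam * AR1 lam x \<eta> n \<omega> + \<eta> (Suc n) \<omega>"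

text \<open>Meaningful for those \<open>u\<close> at which \<open>exp (u * Z)\<close> is integrable.\<close>

definition cumulant :: "'a measure \<Rightarrow> ('a \<Rightarrow> real) \<Rightarrow> real \<Rightarrow> real" where
  "cumulant M Z u = ln (\<integral>\<omega>. exp (u * Z \<omega>) \<partial>M)"

definition cumulant_sum :: "'a measure \<Rightarrow> real \<Rightarrow> ('a \<Rightarrow> real) \<Rightarrow> real \<Rightarrow> real" where
  "cumulant_sum M lam Z u = (\<Sum>k. cumulant M Z (lam ^ k * u))"

definition W_integrand :: "(real \<Rightarrow> real) \<Rightarrow> real \<Rightarrow> real \<Rightarrow> real \<Rightarrow> real" where
  "W_integrand \<phi> v y u = (exp (u * y - \<phi> u) - 1) * u powr (v - 1)"

definition W :: "(real \<Rightarrow> real) \<Rightarrow> real \<Rightarrow> real \<Rightarrow> real" where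
  "W \<phi> v y = (LBINT u:{0<..}. W_integrand \<phi> v y u)"

definition nat_filtration :: "'a measure \<Rightarrow> (nat \<Rightarrow> 'a \<Rightarrow> real) \<Rightarrow> nat \<Rightarrow> 'a measure" where
  "nat_filtration M X n =
     sigma (space M) {X i -` B \<inter> space M | i B. i \<le> n \<and> B \<in> sets borel}"

definition martingale ::
    "'a measure \<Rightarrow> (nat \<Rightarrow> 'a measure) \<Rightarrow> (nat \<Rightarrow> 'a \<Rightarrow> real) \<Rightarrow> bool" where
  "martingale M F Y \<longleftrightarrow>
     filtration (space M) F \<and>
     (\<forall>n. subalgebra M (F n)) \<and>
     (\<forall>n. Y n \<in> borel_measurable (F n)) \<and>
     (\<forall>n. integrable M (Y n)) \<and>
     (\<forall>m n. m \<le> n \<longrightarrow> (AE \<omega> in M. real_cond_exp M (F m) (Y n) \<omega> = Y m \<omega>))"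

end

theory Submission
  imports Defs
begin

text \<open>
  Let \<open>\<nu>\<close> be the law of the innovations and \<open>\<lambda>\<close> the autoregression coefficient. Since \<open>\<phi> u = \<psi> u + \<phi> (\<lambda> u)\<close> and
  \<open>exp (u z - \<psi> u)\<close> has \<open>\<nu>\<close>-mean one, averaging \<open>exp (u (\<lambda> y + z) - \<phi> u) - 1\<close> over \<open>z\<close> gives
  \<open>exp (\<lambda> u y - \<phi> (\<lambda> u)) - 1\<close>. Integrating against \<open>u powr (v - 1)\<close> and substituting
  \<open>s = \<lambda> u\<close> yields the identity \<open>E W (\<lambda> y + \<eta>) = \<lambda> powr (- v) * W y\<close> (\<open>W_step\<close>). Conditionally on
  the past, the innovation \<open>\<eta> (n + 1)\<close> still has law \<open>\<nu>\<close> (\<open>real_cond_exp_indep\<close>), so this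
  identity is the martingale property.

  The analytic content lies in justifying Fubini's theorem. Near \<open>u = 0\<close> the weight
  \<open>u powr (v - 1)\<close> is not integrable. The moment of order \<open>\<delta>\<close> of the negative part compensates
  for this: with the mean of \<open>exp \<eta>\<close>, it gives \<open>E \<bar>exp (u \<eta>) - 1\<bar> \<le> K * u powr \<delta>\<close> on \<open>[0, 1]\<close>, hence bounds of order
  \<open>u powr \<delta>\<close> for \<open>\<psi>\<close> and \<open>\<phi>\<close>, while \<open>u powr (\<delta> + v - 1)\<close> is integrable near \<open>0\<close> because
  \<open>- \<delta> < v\<close>. Together with the assumed convergence over \<open>[1, \<infinity>)\<close>, this makes \<open>W y\<close> absolutely
  convergent for \<open>y\<close> in the state space (\<open>h_integrable\<close>).

  Integrability of \<open>W (X n)\<close> comes from the same computation with absolute values. If \<open>G y\<close> is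
  the integral of the modulus of the integrand of \<open>W y\<close>, then
  \<open>E G (\<lambda> y + \<eta>) \<le> \<lambda> powr (- v) * G y + A\<close> with a finite constant \<open>A\<close> (\<open>G_step\<close>). This holds
  for every real \<open>y\<close>, with \<open>G\<close> valued in the extended half-line, so \<open>E G (X n)\<close> is finite for
  all \<open>n\<close> by induction from \<open>G x < \<infinity>\<close>.
\<close>

section \<open>Elementary inequalities\<close>

lemma exp_minus_one_powr_bound:
  fixes u z \<delta> :: real
  assumes "0 \<le> u" "u \<le> 1" "0 < \<delta>" "\<delta> \<le> 1"
  shows "\<bar>exp (u * z) - 1\<bar> \<le> u powr \<delta> * (exp z + max (- z) 0 powr \<delta>)"
proof (cases "z \<ge> 0")
  case True
  have u_le: "u \<le> u powr \<delta>"
    using powr_mono'[of \<delta> 1 u] assms by simp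
  \<comment> \<open>convexity of \<open>exp\<close> along the segment from \<open>0\<close> to \<open>z\<close>\<close>
  have "exp ((1 - u) * 0 + u * z) \<le> (1 - u) * exp 0 + u * exp z"
    using convex_onD[OF exp_convex, of u 0 z] assms by simp
  then have "\<bar>exp (u * z) - 1\<bar> \<le> u * exp z"
    using True assms by (simp add: algebra_simps)
  also have "\<dots> \<le> u powr \<delta> * exp z"
    using u_le by (intro mult_right_mono) auto
  also have "\<dots> \<le> u powr \<delta> * (exp z + max (- z) 0 powr \<delta>)"
    by (intro mult_left_mono) auto
  finally show ?thesis .
next
  case False
  define t where "t = u * (- z)"
  have t: "0 \<le> t" using False assms by (auto simp: t_def mult_nonneg_nonpos)
  have "\<bar>exp (u * z) - 1\<bar> = 1 - exp (- t)"
    using t by (simp add: t_def)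
  also have "\<dots> \<le> min 1 t"
    using exp_ge_add_one_self[of "- t"] by auto
  also have "\<dots> \<le> t powr \<delta>"
  proof (cases "t \<le> 1")
    case True
    then show ?thesis using powr_mono'[of \<delta> 1 t] assms t by simp
  next
    case False
    then show ?thesis using ge_one_powr_ge_zero[of t \<delta>] assms by simp
  qed
  also have "\<dots> = u powr \<delta> * max (- z) 0 powr \<delta>"
    using False assms by (simp add: t_def flip: powr_mult)
  also have "\<dots> \<le> u powr \<delta> * (exp z + max (- z) 0 powr \<delta>)"
    by (intro mult_left_mono) auto
  finally show ?thesis .
qed

lemma abs_exp_minus_one_le: "\<bar>exp z - 1\<bar> \<le> \<bar>z\<bar> * exp \<bar>z\<bar>" for z :: real
proof (cases "z \<ge> 0")
  case True
  have "1 - z \<le> exp (- z)" using exp_ge_add_one_self[of "- z"] by simp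
  then have "exp z * (1 - z) \<le> exp z * exp (- z)" by (intro mult_left_mono) auto
  then show ?thesis using True by (simp add: algebra_simps flip: exp_add)
next
  case False
  have "1 - exp z \<le> - z" using exp_ge_add_one_self[of z] by linarith
  also have "\<dots> \<le> - z * exp (- z)" using False by (simp add: mult_le_cancel_left1)
  finally show ?thesis using False by simp
qed

lemma abs_ln_le:
  fixes c m :: real
  assumes "0 < m" "m \<le> 1" "m \<le> c"
  shows "\<bar>ln c\<bar> \<le> \<bar>c - 1\<bar> / m"
proof (cases "c \<ge> 1")
  case True
  have "ln c \<le> c - 1" using ln_le_minus_one[of c] True by simp
  also have "\<dots> \<le> (c - 1) / m" using True assms by (simp add: le_divide_eq mult_left_le)
  finally show ?thesis using True by simp
next
  case False
  have "ln (1 / c) \<le> 1 / c - 1" using ln_le_minus_one[of "1 / c"] assms by simp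
  also have "\<dots> = (1 - c) / c" using assms by (simp add: field_simps)
  also have "\<dots> \<le> (1 - c) / m" using False assms by (intro divide_left_mono) auto
  finally show ?thesis using False assms by (simp add: ln_div)
qed

section \<open>The cumulant function and its geometric sum\<close>

text \<open>The law \<open>\<nu>\<close> of a single innovation, with all exponential moments of nonnegative order and a
  moment of order \<open>\<delta>\<close> of the negative part. The innovation itself is the identity on the line.\<close>

locale ar1_noise = prob_space \<nu> for \<nu> :: "real measure" +
  fixes lam v \<delta> :: real
  assumes sets_nu [measurable_cong]: "sets \<nu> = sets borel"
    and lam: "0 < lam" "lam < 1"
    and v_neg: "v < 0" and delta: "0 < \<delta>" "\<delta> \<le> 1" and v_gt: "- \<delta> < v"
    and exp_int: "\<And>u. 0 \<le> u \<Longrightarrow> integrable \<nu> (\<lambda>z. exp (u * z))"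
    and neg_int: "integrable \<nu> (\<lambda>z. max (- z) 0 powr \<delta>)"
begin

abbreviation \<psi> :: "real \<Rightarrow> real" where "\<psi> \<equiv> cumulant \<nu> (\<lambda>z. z)"

abbreviation \<phi> :: "real \<Rightarrow> real" where "\<phi> \<equiv> cumulant_sum \<nu> lam (\<lambda>z. z)"

lemma space_nu [simp]: "space \<nu> = UNIV"
  using sets_eq_imp_space_eq[OF sets_nu] by simp

lemma prob_UNIV [simp]: "prob UNIV = 1"
  using prob_space by simp

lemma expectation_pos:
  fixes f :: "real \<Rightarrow> real"
  assumes "integrable \<nu> f" "\<And>z. 0 < f z"
  shows "0 < (\<integral>z. f z \<partial>\<nu>)"
  using integral_less_AE_space[of "\<lambda>_. 0" f] assms by (auto simp: emeasure_eq_measure)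

lemma exp_psi: "0 \<le> u \<Longrightarrow> exp (\<psi> u) = (\<integral>z. exp (u * z) \<partial>\<nu>)"
  unfolding cumulant_def by (subst exp_ln) (auto intro!: expectation_pos exp_int)

lemma normalised_exp_integral:
  assumes "0 \<le> u"
  shows "integrable \<nu> (\<lambda>z. exp (u * z - \<psi> u))" "(\<integral>z. exp (u * z - \<psi> u) \<partial>\<nu>) = 1"
  using exp_int[OF assms] by (auto simp: exp_diff exp_psi[OF assms, symmetric])

text \<open>\<open>K\<close> is the constant in the bound of order \<open>u powr \<delta>\<close> for the deviation of \<open>exp (u z)\<close> from
  one.\<close>

definition K :: real where "K = (\<integral>z. exp z + max (- z) 0 powr \<delta> \<partial>\<nu>)"

text \<open>\<open>m\<close> is a lower bound, uniform in \<open>u \<in> [0, 1]\<close>, for the moment generating function.\<close>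

definition m :: real where "m = (\<integral>z. min 1 (exp z) \<partial>\<nu>)"

lemma exp_int1: "integrable \<nu> (\<lambda>z. exp z)"
  using exp_int[of 1] by simp

lemma K_nonneg: "0 \<le> K"
  unfolding K_def by (intro Bochner_Integration.integral_nonneg) auto

lemma min_int: "integrable \<nu> (\<lambda>z. min 1 (exp z))"
  by (rule integrable_const_bound[where B = 1]) auto

lemma m_pos: "0 < m"
  unfolding m_def using min_int by (rule expectation_pos) auto

lemma m_le_1: "m \<le> 1"
  unfolding m_def using min_int by (rule integral_le_const) auto

lemma exp_psi_ge_m:
  assumes "0 \<le> u" "u \<le> 1"
  shows "m \<le> exp (\<psi> u)"
  unfolding exp_psi[OF assms(1)] m_def
proof (rule integral_mono[OF min_int exp_int[OF assms(1)]])
  fix z :: real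
  show "min 1 (exp z) \<le> exp (u * z)"
  proof (cases "z \<ge> 0")
    case True
    then show ?thesis using assms by (simp add: min.coboundedI1)
  next
    case False
    then show ?thesis using assms by (simp add: min.coboundedI2 mult_le_cancel_right1)
  qed
qed

lemma exp_deviation_int: "0 \<le> u \<Longrightarrow> integrable \<nu> (\<lambda>z. \<bar>exp (u * z) - 1\<bar>)"
  by (intro integrable_abs Bochner_Integration.integrable_diff exp_int) auto

lemma exp_deviation_le:
  assumes "0 \<le> u" "u \<le> 1"
  shows "(\<integral>z. \<bar>exp (u * z) - 1\<bar> \<partial>\<nu>) \<le> K * u powr \<delta>"
proof -
  have "(\<integral>z. \<bar>exp (u * z) - 1\<bar> \<partial>\<nu>) \<le> (\<integral>z. u powr \<delta> * (exp z + max (- z) 0 powr \<delta>) \<partial>\<nu>)"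
    using assms delta
    by (intro integral_mono exp_deviation_int exp_minus_one_powr_bound integrable_mult_right
          Bochner_Integration.integrable_add exp_int1 neg_int) auto
  then show ?thesis by (simp add: K_def mult.commute)
qed

lemma exp_psi_deviation_le:
  assumes "0 \<le> u" "u \<le> 1"
  shows "\<bar>exp (\<psi> u) - 1\<bar> \<le> K * u powr \<delta>"
proof -
  have "exp (\<psi> u) - 1 = (\<integral>z. exp (u * z) - 1 \<partial>\<nu>)"
    using assms by (simp add: exp_psi exp_int prob_space)
  also have "\<bar>\<dots>\<bar> \<le> (\<integral>z. \<bar>exp (u * z) - 1\<bar> \<partial>\<nu>)"
    by (rule integral_abs_bound)
  finally show ?thesis using exp_deviation_le[OF assms] by simp
qed

lemma psi_bound:
  assumes "0 \<le> u" "u \<le> 1"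
  shows "\<bar>\<psi> u\<bar> \<le> K / m * u powr \<delta>"
proof -
  have "\<bar>\<psi> u\<bar> \<le> \<bar>exp (\<psi> u) - 1\<bar> / m"
    using abs_ln_le[OF m_pos m_le_1 exp_psi_ge_m[OF assms]] by simp
  also have "\<dots> \<le> K * u powr \<delta> / m"
    using exp_psi_deviation_le[OF assms] m_pos by (intro divide_right_mono) auto
  finally show ?thesis by simp
qed

lemma lam_powr_lt_1: "lam powr \<delta> < 1"
  using lam delta powr_less_mono2[of \<delta> lam 1] by simp

lemma psi_geometric_bound:
  assumes "0 \<le> u" "u \<le> 1"
  shows "\<bar>\<psi> (lam ^ k * u)\<bar> \<le> K / m * u powr \<delta> * (lam powr \<delta>) ^ k"
proof -
  have "lam ^ k * u \<le> 1"
    using lam assms by (intro mult_le_one power_le_one) auto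
  then have "\<bar>\<psi> (lam ^ k * u)\<bar> \<le> K / m * (lam ^ k * u) powr \<delta>"
    using lam assms by (intro psi_bound) auto
  also have "(lam ^ k * u) powr \<delta> = (lam powr \<delta>) ^ k * u powr \<delta>"
    using lam assms by (simp add: powr_mult powr_powr powr_realpow[symmetric] mult.commute)
  finally show ?thesis by (simp add: mult_ac)
qed

lemma summable_psi_01:
  assumes "0 \<le> u" "u \<le> 1"
  shows "summable (\<lambda>k. \<psi> (lam ^ k * u))"
  by (rule summable_comparison_test'[where N = 0 and g = "\<lambda>k. K / m * u powr \<delta> * (lam powr \<delta>) ^ k"])
     (use psi_geometric_bound[OF assms] lam_powr_lt_1 in \<open>auto intro!: summable_mult summable_geometric\<close>)

lemma summable_psi:
  assumes "0 \<le> u"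
  shows "summable (\<lambda>k. \<psi> (lam ^ k * u))"
proof -
  have "(\<lambda>n. lam ^ n * u) \<longlonglongrightarrow> 0 * u"
    using lam by (intro tendsto_mult LIMSEQ_realpow_zero tendsto_const) auto
  then have "\<forall>\<^sub>F n in sequentially. lam ^ n * u < 1"
    by (intro order_tendstoD(2)) auto
  then obtain N where "lam ^ N * u < 1" by (auto simp: eventually_sequentially)
  \<comment> \<open>the tail of the series at \<open>u\<close> is the series at a point of the unit interval\<close>
  then have "summable (\<lambda>k. \<psi> (lam ^ k * (lam ^ N * u)))"
    using lam assms by (intro summable_psi_01) auto
  then have "summable (\<lambda>k. \<psi> (lam ^ (k + N) * u))"
    by (simp add: power_add mult.assoc)
  then show ?thesis by (rule summable_iff_shift[THEN iffD1])
qed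

lemma phi_step: "0 \<le> u \<Longrightarrow> \<phi> u = \<psi> u + \<phi> (lam * u)"
  using suminf_split_head[OF summable_psi[of u]]
  by (simp add: cumulant_sum_def mult_ac)

text \<open>\<open>C * u powr \<delta>\<close> is the sum of the geometric series that dominates the series \<open>\<phi> u\<close> for
  \<open>u \<in> [0, 1]\<close>.\<close>

definition C :: real where "C = K / m / (1 - lam powr \<delta>)"

lemma C_nonneg: "0 \<le> C"
  unfolding C_def using K_nonneg m_pos lam_powr_lt_1 by auto

lemma phi_bound:
  assumes "0 \<le> u" "u \<le> 1"
  shows "\<bar>\<phi> u\<bar> \<le> C * u powr \<delta>"
proof -
  have g: "(\<lambda>k. K / m * u powr \<delta> * (lam powr \<delta>) ^ k) sums (K / m * u powr \<delta> * (1 / (1 - lam powr \<delta>)))"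
    using lam_powr_lt_1 by (intro sums_mult geometric_sums) auto
  have s: "summable (\<lambda>k. \<bar>\<psi> (lam ^ k * u)\<bar>)"
    by (rule summable_comparison_test'[where N = 0, OF sums_summable[OF g]])
       (use psi_geometric_bound[OF assms] in auto)
  have "\<bar>\<phi> u\<bar> \<le> (\<Sum>k. \<bar>\<psi> (lam ^ k * u)\<bar>)"
    unfolding cumulant_sum_def by (rule summable_rabs[OF s])
  also have "\<dots> \<le> (\<Sum>k. K / m * u powr \<delta> * (lam powr \<delta>) ^ k)"
    by (rule suminf_le[OF psi_geometric_bound[OF assms] s sums_summable[OF g]])
  also have "\<dots> = C * u powr \<delta>"
    using sums_unique[OF g] by (simp add: C_def)
  finally show ?thesis .
qed

lemma psi_measurable [measurable]: "\<psi> \<in> borel_measurable borel"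
  unfolding cumulant_def by measurable

lemma phi_measurable [measurable]: "\<phi> \<in> borel_measurable borel"
  unfolding cumulant_sum_def by measurable

section \<open>Absolute convergence of the integral transform\<close>

text \<open>The integrand of \<open>W\<close>, extended by \<open>0\<close> to the whole line.\<close>

definition h :: "real \<Rightarrow> real \<Rightarrow> real" where
  "h y u = indicator {0<..} u * W_integrand \<phi> v y u"

lemma h_measurable [measurable]: "case_prod h \<in> borel_measurable (borel \<Otimes>\<^sub>M borel)"
  unfolding h_def W_integrand_def by measurable

lemma W_eq_h: "W \<phi> v y = (\<integral>u. h y u \<partial>lborel)"
  unfolding W_def h_def set_lebesgue_integral_def by simp

lemma W_measurable [measurable]: "W \<phi> v \<in> borel_measurable borel"
  unfolding W_eq_h[abs_def] by measurable

text \<open>The common dominating function for the integrals over \<open>u > 0\<close>: \<open>u powr (\<delta> + v - 1)\<close> on the unit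
  interval and \<open>u powr (v - 1)\<close> beyond it, integrable because \<open>- \<delta> < v < 0\<close>. Both terms contribute at \<open>u = 1\<close>, which does no harm to an upper bound.\<close>

definition q :: "real \<Rightarrow> real" where
  "q u = indicator {0..1} u * u powr (\<delta> + v - 1) + indicator {1..} u * u powr (v - 1)"

lemma q_nonneg: "0 \<le> q u"
  by (auto simp: q_def)

lemma q_measurable [measurable]: "q \<in> borel_measurable borel"
  unfolding q_def by measurable

lemma q_nn_integral: "(\<integral>\<^sup>+u. q u \<partial>lborel) < \<infinity>"
proof -
  have 1: "(\<integral>\<^sup>+u. ennreal (indicator {0..1} u * u powr (\<delta> + v - 1)) \<partial>lborel) < \<infinity>"
    using nn_integral_has_integral_lebesgue[OF _ has_integral_powr_from_0[of "\<delta> + v - 1" 1]] v_gt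
    by (simp add: mult.commute)
  have 2: "(\<integral>\<^sup>+u. ennreal (indicator {1..} u * u powr (v - 1)) \<partial>lborel) < \<infinity>"
    using nn_integral_has_integral_lebesgue[OF _ has_integral_powr_to_inf[of "v - 1" 1]] v_neg
    by simp
  have "(\<integral>\<^sup>+u. q u \<partial>lborel) = (\<integral>\<^sup>+u. ennreal (indicator {0..1} u * u powr (\<delta> + v - 1)) \<partial>lborel)
     + (\<integral>\<^sup>+u. ennreal (indicator {1..} u * u powr (v - 1)) \<partial>lborel)"
    unfolding q_def by (subst nn_integral_add[symmetric]) (auto simp: ennreal_plus)
  then show ?thesis using 1 2 by (simp add: less_top)
qed

lemma q_integrable: "integrable lborel q"
  using q_nn_integral q_nonneg by (intro integrableI_nonneg) auto

lemma h_integrable: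
  assumes "set_integrable lborel {1..} (\<lambda>u. exp (u * y - \<phi> u) * u powr (v - 1))"
  shows "integrable lborel (h y)"
proof -
  define B where "B = (\<bar>y\<bar> + C) * exp (\<bar>y\<bar> + C)"
  define g where "g u = indicator {1..} u *\<^sub>R (exp (u * y - \<phi> u) * u powr (v - 1))" for u
  have B: "0 \<le> B" using C_nonneg by (simp add: B_def)
  have g_nonneg: "0 \<le> g u" for u by (auto simp: g_def)
  have "integrable lborel (\<lambda>u. (B + 1) * q u + g u)"
    using assms q_integrable unfolding set_integrable_def g_def by auto
  moreover have "\<bar>h y u\<bar> \<le> (B + 1) * q u + g u" for u
  proof -
    consider "u \<le> 0" | "0 < u" "u < 1" | "1 \<le> u" by linarith
    then show ?thesis
    proof cases
      case 1
      then show ?thesis using q_nonneg[of u] B g_nonneg[of u] by (auto simp: h_def)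
    next
      case 2
      define t where "t = u * y - \<phi> u"
      have u_le: "u \<le> u powr \<delta>" and le1: "u powr \<delta> \<le> 1"
        using powr_mono'[of \<delta> 1 u] powr_mono'[of 0 \<delta> u] 2 delta by auto
      have "\<bar>t\<bar> \<le> u * \<bar>y\<bar> + C * u powr \<delta>"
        using phi_bound[of u] 2 by (auto simp: t_def abs_mult intro: order_trans[OF abs_triangle_ineq4])
      also have "\<dots> \<le> u powr \<delta> * \<bar>y\<bar> + C * u powr \<delta>"
        using u_le by (intro add_mono mult_right_mono) auto
      finally have t: "\<bar>t\<bar> \<le> (\<bar>y\<bar> + C) * u powr \<delta>" by (simp add: algebra_simps)
      also have "\<dots> \<le> \<bar>y\<bar> + C"
        using le1 C_nonneg by (intro mult_left_le) auto
      finally have "\<bar>exp t - 1\<bar> \<le> ((\<bar>y\<bar> + C) * u powr \<delta>) * exp (\<bar>y\<bar> + C)"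
        using t C_nonneg by (intro order_trans[OF abs_exp_minus_one_le] mult_mono) auto
      then have "\<bar>exp t - 1\<bar> * u powr (v - 1) \<le> B * u powr \<delta> * u powr (v - 1)"
        by (intro mult_right_mono) (auto simp: B_def mult_ac)
      then have "\<bar>h y u\<bar> \<le> B * q u"
        using 2 by (simp add: h_def W_integrand_def q_def t_def abs_mult powr_add[symmetric] mult.assoc add_diff_eq)
      then show ?thesis using q_nonneg[of u] g_nonneg[of u] by (simp add: algebra_simps)
    next
      case 3
      have "\<bar>h y u\<bar> \<le> (exp (u * y - \<phi> u) + 1) * u powr (v - 1)"
        using 3 by (auto simp: h_def W_integrand_def abs_mult intro!: mult_right_mono
            intro: order_trans[OF abs_triangle_ineq4])
      also have "\<dots> \<le> q u + g u"
        using 3 by (simp add: g_def q_def algebra_simps)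
      also have "\<dots> \<le> (B + 1) * q u + g u"
        using B q_nonneg[of u] by (simp add: algebra_simps)
      finally show ?thesis .
    qed
  qed
  ultimately show ?thesis
    by (intro Bochner_Integration.integrable_bound[of lborel "\<lambda>u. (B + 1) * q u + g u" "h y"])
       (auto intro: AE_I2 order_trans[OF _ abs_ge_self])
qed

section \<open>One step of the recursion\<close>

text \<open>\<open>d u\<close> is the mean deviation from one of the normalised exponential \<open>exp (u z - \<psi> u)\<close>.\<close>

definition d :: "real \<Rightarrow> real" where
  "d u = (\<integral>z. \<bar>exp (u * z - \<psi> u) - 1\<bar> \<partial>\<nu>)"

lemma d_measurable [measurable]: "d \<in> borel_measurable borel"
  unfolding d_def by measurable

lemma d_int: "0 \<le> u \<Longrightarrow> integrable \<nu> (\<lambda>z. \<bar>exp (u * z - \<psi> u) - 1\<bar>)"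
  using normalised_exp_integral(1)[of u] by (intro integrable_abs Bochner_Integration.integrable_diff) auto

lemma d_nonneg: "0 \<le> d u"
  unfolding d_def by simp

lemma d_le_2:
  assumes "0 \<le> u"
  shows "d u \<le> 2"
proof -
  have "d u \<le> (\<integral>z. exp (u * z - \<psi> u) + 1 \<partial>\<nu>)"
    unfolding d_def using normalised_exp_integral[OF assms] d_int[OF assms]
    by (intro integral_mono) (auto intro: order_trans[OF abs_triangle_ineq4])
  also have "\<dots> = 2" using normalised_exp_integral[OF assms] by (simp add: prob_space)
  finally show ?thesis .
qed

lemma d_le_powr:
  assumes "0 \<le> u" "u \<le> 1"
  shows "d u \<le> 2 * K / m * u powr \<delta>"
proof -
  have "d u \<le> (\<integral>z. (\<bar>exp (u * z) - 1\<bar> + \<bar>exp (\<psi> u) - 1\<bar>) / m \<partial>\<nu>)"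
    unfolding d_def
  proof (rule integral_mono[OF d_int[OF assms(1)]])
    show "integrable \<nu> (\<lambda>z. (\<bar>exp (u * z) - 1\<bar> + \<bar>exp (\<psi> u) - 1\<bar>) / m)"
      using exp_deviation_int[OF assms(1)] by auto
    fix z
    have "\<bar>exp (u * z - \<psi> u) - 1\<bar> = \<bar>(exp (u * z) - 1) - (exp (\<psi> u) - 1)\<bar> / exp (\<psi> u)"
      by (simp add: exp_diff field_simps abs_if)
    also have "\<dots> \<le> (\<bar>exp (u * z) - 1\<bar> + \<bar>exp (\<psi> u) - 1\<bar>) / m"
      using exp_psi_ge_m[OF assms] m_pos by (intro frac_le abs_triangle_ineq4) auto
    finally show "\<bar>exp (u * z - \<psi> u) - 1\<bar> \<le> (\<bar>exp (u * z) - 1\<bar> + \<bar>exp (\<psi> u) - 1\<bar>) / m" .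
  qed
  also have "\<dots> = ((\<integral>z. \<bar>exp (u * z) - 1\<bar> \<partial>\<nu>) + \<bar>exp (\<psi> u) - 1\<bar>) / m"
    using exp_deviation_int[OF assms(1)] by (simp add: prob_space)
  also have "\<dots> \<le> (K * u powr \<delta> + K * u powr \<delta>) / m"
    using exp_deviation_le[OF assms] exp_psi_deviation_le[OF assms] m_pos
    by (intro divide_right_mono add_mono) auto
  finally show ?thesis by simp
qed

text \<open>\<open>G y\<close> is the integral of the modulus of the integrand of \<open>W y\<close>. Infinite values are allowed,
  so that it is a measurable function of every real \<open>y\<close>.\<close>

definition G :: "real \<Rightarrow> ennreal" where
  "G y = (\<integral>\<^sup>+u. ennreal \<bar>h y u\<bar> \<partial>lborel)"

lemma G_measurable [measurable]: "G \<in> borel_measurable borel"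
  unfolding G_def by measurable

lemma integrable_h_iff: "integrable lborel (h y) \<longleftrightarrow> G y < \<infinity>"
  by (simp add: integrable_iff_bounded G_def)

text \<open>If the integral diverges, then \<open>W y\<close> has the default value \<open>0\<close> and the bound still holds.\<close>

lemma abs_W_le: "ennreal \<bar>W \<phi> v y\<bar> \<le> G y"
proof (cases "integrable lborel (h y)")
  case True
  then show ?thesis
    using integral_norm_bound_ennreal[OF True] by (simp add: W_eq_h G_def)
next
  case False
  then show ?thesis by (simp add: W_eq_h not_integrable_integral_eq)
qed

text \<open>\<open>A\<close> is the additive error of one step in the recursive bound for \<open>G\<close>. It does not depend on
  the current state.\<close>

definition A :: ennreal where
  "A = (\<integral>\<^sup>+u. ennreal (indicator {0<..} u * (d u * u powr (v - 1))) \<partial>lborel)"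

lemma A_finite: "A < \<infinity>"
proof -
  have "A \<le> (\<integral>\<^sup>+u. ennreal ((2 * K / m + 2) * q u) \<partial>lborel)"
    unfolding A_def
  proof (intro nn_integral_mono ennreal_leI)
    fix u :: real
    have nn: "0 \<le> 2 * K / m" using K_nonneg m_pos by simp
    consider "u \<le> 0" | "0 < u" "u < 1" | "1 \<le> u" by linarith
    then show "indicator {0<..} u * (d u * u powr (v - 1)) \<le> (2 * K / m + 2) * q u"
    proof cases
      case 1
      then show ?thesis using nn q_nonneg[of u] by auto
    next
      case 2
      then have "d u * u powr (v - 1) \<le> 2 * K / m * u powr \<delta> * u powr (v - 1)"
        by (intro mult_right_mono d_le_powr) auto
      also have "\<dots> = 2 * K / m * q u"
        using 2 by (simp add: q_def mult.assoc add_diff_eq flip: powr_add)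
      also have "\<dots> \<le> (2 * K / m + 2) * q u"
        using q_nonneg[of u] by (intro mult_right_mono) auto
      finally show ?thesis using 2 by simp
    next
      case 3
      then have "d u * u powr (v - 1) \<le> 2 * u powr (v - 1)"
        by (intro mult_right_mono d_le_2) auto
      also have "\<dots> \<le> 2 * q u" by (use 3 in \<open>auto simp: q_def\<close>)
      also have "\<dots> \<le> (2 * K / m + 2) * q u"
        using q_nonneg[of u] nn by (intro mult_right_mono) auto
      finally show ?thesis using 3 by simp
    qed
  qed
  also have "\<dots> = ennreal (2 * K / m + 2) * (\<integral>\<^sup>+u. q u \<partial>lborel)"
    using K_nonneg m_pos q_nonneg by (simp add: ennreal_mult' nn_integral_cmult)
  also have "\<dots> < \<infinity>" using q_nn_integral by (simp add: ennreal_mult_less_top)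
  finally show ?thesis .
qed

text \<open>The split of the integrand behind both the mean identity and the bound in absolute value: the
  second summand has \<open>\<nu>\<close>-mean zero and does not involve \<open>y\<close>.\<close>

lemma h_shift:
  assumes "0 < u"
  shows "h (lam * y + z) u =
    exp (u * z - \<psi> u) * (lam powr (1 - v) * h y (lam * u)) + (exp (u * z - \<psi> u) - 1) * u powr (v - 1)"
proof -
  have e: "exp (u * (lam * y + z) - \<phi> u) = exp (u * z - \<psi> u) * exp (lam * u * y - \<phi> (lam * u))"
    using assms by (simp add: phi_step[of u] algebra_simps flip: exp_add)
  have "lam powr (1 - v) * (lam * u) powr (v - 1) = u powr (v - 1)"
    using lam assms by (simp add: powr_mult flip: powr_add mult.assoc)
  then have "lam powr (1 - v) * h y (lam * u) = (exp (lam * u * y - \<phi> (lam * u)) - 1) * u powr (v - 1)"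
    using lam assms by (simp add: h_def W_integrand_def mult_ac)
  moreover have "h (lam * y + z) u =
      (exp (u * z - \<psi> u) * exp (lam * u * y - \<phi> (lam * u)) - 1) * u powr (v - 1)"
    using assms by (simp add: h_def W_integrand_def e)
  ultimately show ?thesis
    by (simp only:) (simp add: algebra_simps)
qed

lemma h_nonpos: "u \<le> 0 \<Longrightarrow> h y u = 0"
  by (simp add: h_def)

lemma h_step_integral: "(\<integral>z. h (lam * y + z) u \<partial>\<nu>) = lam powr (1 - v) * h y (lam * u)"
proof (cases "0 < u")
  case True
  then show ?thesis
    using normalised_exp_integral[of u] by (simp add: h_shift prob_space)
next
  case False
  then show ?thesis using lam by (simp add: h_nonpos mult_nonneg_nonpos)
qed

lemma h_step_bound:
  "(\<integral>\<^sup>+z. ennreal \<bar>h (lam * y + z) u\<bar> \<partial>\<nu>) \<le>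
     ennreal (lam powr (1 - v) * \<bar>h y (lam * u)\<bar>) + ennreal (indicator {0<..} u * (d u * u powr (v - 1)))"
proof (cases "0 < u")
  case True
  define b where "b = lam powr (1 - v) * \<bar>h y (lam * u)\<bar>"
  have i: "integrable \<nu> (\<lambda>z. exp (u * z - \<psi> u) * b + \<bar>exp (u * z - \<psi> u) - 1\<bar> * u powr (v - 1))"
    using True by (intro Bochner_Integration.integrable_add integrable_mult_left normalised_exp_integral d_int) auto
  have "(\<integral>\<^sup>+z. ennreal \<bar>h (lam * y + z) u\<bar> \<partial>\<nu>) \<le>
      (\<integral>\<^sup>+z. ennreal (exp (u * z - \<psi> u) * b + \<bar>exp (u * z - \<psi> u) - 1\<bar> * u powr (v - 1)) \<partial>\<nu>)"
    unfolding h_shift[OF True] b_def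
    by (intro nn_integral_mono ennreal_leI order_trans[OF abs_triangle_ineq]) (simp add: abs_mult)
  also have "\<dots> = ennreal (\<integral>z. exp (u * z - \<psi> u) * b + \<bar>exp (u * z - \<psi> u) - 1\<bar> * u powr (v - 1) \<partial>\<nu>)"
    by (rule nn_integral_eq_integral[OF i]) (auto simp: b_def)
  also have "\<dots> = ennreal (b + d u * u powr (v - 1))"
    using True normalised_exp_integral[of u] d_int[of u] by (simp add: d_def)
  also have "\<dots> = ennreal b + ennreal (d u * u powr (v - 1))"
    using d_nonneg by (intro ennreal_plus) (auto simp: b_def)
  finally show ?thesis using True by (simp add: b_def)
next
  case False
  then show ?thesis by (simp add: h_nonpos)
qed

sublocale pair_sigma_finite \<nu> lborel ..

lemma G_step: "(\<integral>\<^sup>+z. G (lam * y + z) \<partial>\<nu>) \<le> ennreal (lam powr (- v)) * G y + A"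
proof -
  have scale: "(\<integral>\<^sup>+u. ennreal \<bar>h y (lam * u)\<bar> \<partial>lborel) = ennreal (1 / lam) * G y"
  proof -
    have "G y = ennreal lam * (\<integral>\<^sup>+u. ennreal \<bar>h y (lam * u)\<bar> \<partial>lborel)"
      unfolding G_def using lam by (subst nn_integral_real_affine[where c = lam and t = 0]) auto
    then have "ennreal (1 / lam) * G y = ennreal (1 / lam) * ennreal lam * (\<integral>\<^sup>+u. ennreal \<bar>h y (lam * u)\<bar> \<partial>lborel)"
      by (simp add: mult.assoc)
    also have "ennreal (1 / lam) * ennreal lam = 1"
      using lam by (simp flip: ennreal_mult)
    finally show ?thesis by simp
  qed
  have "(\<integral>\<^sup>+z. G (lam * y + z) \<partial>\<nu>) = (\<integral>\<^sup>+u. (\<integral>\<^sup>+z. ennreal \<bar>h (lam * y + z) u\<bar> \<partial>\<nu>) \<partial>lborel)"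
    unfolding G_def by (rule Fubini'[symmetric]) measurable
  also have "\<dots> \<le> (\<integral>\<^sup>+u. ennreal (lam powr (1 - v) * \<bar>h y (lam * u)\<bar>) +
      ennreal (indicator {0<..} u * (d u * u powr (v - 1))) \<partial>lborel)"
    by (intro nn_integral_mono h_step_bound)
  also have "\<dots> = (\<integral>\<^sup>+u. ennreal (lam powr (1 - v) * \<bar>h y (lam * u)\<bar>) \<partial>lborel) + A"
    unfolding A_def by (rule nn_integral_add) auto
  also have "(\<integral>\<^sup>+u. ennreal (lam powr (1 - v) * \<bar>h y (lam * u)\<bar>) \<partial>lborel) =
      ennreal (lam powr (1 - v)) * (ennreal (1 / lam) * G y)"
    by (simp add: ennreal_mult' nn_integral_cmult scale)
  also have "\<dots> = ennreal (lam powr (- v)) * G y"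
    using lam by (simp add: powr_diff powr_minus_divide flip: mult.assoc ennreal_mult)
  finally show ?thesis .
qed

text \<open>If \<open>G y\<close> is finite, then the bound in \<open>G_step\<close> is finite, and this is the absolute
  integrability that Fubini's theorem requires.\<close>

lemma W_step:
  assumes "G y < \<infinity>"
  shows "(\<integral>z. W \<phi> v (lam * y + z) \<partial>\<nu>) = lam powr (- v) * W \<phi> v y"
proof -
  have "integrable (\<nu> \<Otimes>\<^sub>M lborel) (\<lambda>(z, u). h (lam * y + z) u)"
  proof (subst integrable_iff_bounded, intro conjI)
    have "(\<integral>\<^sup>+p. ennreal (norm (case p of (z, u) \<Rightarrow> h (lam * y + z) u)) \<partial>(\<nu> \<Otimes>\<^sub>M lborel)) =
        (\<integral>\<^sup>+z. G (lam * y + z) \<partial>\<nu>)"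
      unfolding G_def by (subst lborel.nn_integral_fst[symmetric]) (auto simp: split_beta')
    also have "\<dots> < \<infinity>"
      using G_step[of y] assms A_finite
      by (auto simp: ennreal_mult_less_top intro: order.strict_trans1)
    finally show "(\<integral>\<^sup>+p. ennreal (norm (case p of (z, u) \<Rightarrow> h (lam * y + z) u)) \<partial>(\<nu> \<Otimes>\<^sub>M lborel)) < \<infinity>" .
  qed measurable
  then have "(\<integral>z. W \<phi> v (lam * y + z) \<partial>\<nu>) = (\<integral>u. (\<integral>z. h (lam * y + z) u \<partial>\<nu>) \<partial>lborel)"
    unfolding W_eq_h by (rule Fubini_integral[symmetric])
  also have "\<dots> = lam powr (1 - v) * (\<integral>u. h y (lam * u) \<partial>lborel)"
    unfolding h_step_integral by simp
  also have "(\<integral>u. h y (lam * u) \<partial>lborel) = W \<phi> v y / lam"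
    unfolding W_eq_h using lam by (subst (2) lborel_integral_real_affine[where c = lam and t = 0]) auto
  also have "lam powr (1 - v) * (W \<phi> v y / lam) = lam powr (- v) * W \<phi> v y"
    using lam by (simp add: powr_diff powr_minus_divide)
  finally show ?thesis .
qed

end

section \<open>The natural filtration\<close>

lemma space_nat_filtration [simp]: "space (nat_filtration M X n) = space M"
  unfolding nat_filtration_def by (rule space_measure_of) auto

lemma sets_nat_filtration:
  "sets (nat_filtration M X n) = sigma_sets (space M) {X i -` B \<inter> space M | i B. i \<le> n \<and> B \<in> sets borel}"
  unfolding nat_filtration_def by (rule sets_measure_of) auto

lemma nat_filtration_subset:
  assumes "\<And>i. i \<le> n \<Longrightarrow> X i \<in> borel_measurable V" "space V = space M"
  shows "sets (nat_filtration M X n) \<subseteq> sets V"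
  unfolding sets_nat_filtration assms(2)[symmetric]
  using assms(1) by (intro sets.sigma_sets_subset) (auto intro: measurable_sets)

lemma measurable_nat_filtration:
  "i \<le> n \<Longrightarrow> X i \<in> borel_measurable (nat_filtration M X n)"
  unfolding measurable_def by (auto simp: sets_nat_filtration)

lemma filtration_nat_filtration: "filtration (space M) (nat_filtration M X)"
proof
  fix i j :: nat
  assume "i \<le> j"
  then show "sets (nat_filtration M X i) \<subseteq> sets (nat_filtration M X j)"
    unfolding sets_nat_filtration by (intro sigma_sets_mono') (blast intro: le_trans[OF _ \<open>i \<le> j\<close>])
qed simp

lemma subalgebra_nat_filtration:
  assumes "\<And>i. X i \<in> borel_measurable M"
  shows "subalgebra M (nat_filtration M X n)"
  using nat_filtration_subset[of n X M M] assms by (auto simp: subalgebra_def)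

lemma AR1_measurable:
  assumes "\<And>i. 1 \<le> i \<Longrightarrow> i \<le> n \<Longrightarrow> \<eta> i \<in> borel_measurable V"
  shows "AR1 lam x \<eta> n \<in> borel_measurable V"
  using assms
proof (induction n)
  case (Suc n)
  then have [measurable]: "AR1 lam x \<eta> n \<in> borel_measurable V" "\<eta> (Suc n) \<in> borel_measurable V" by auto
  then show ?case by simp
next
  case 0
  then show ?case by (simp cong: measurable_cong)
qed

section \<open>Conditioning on an independent past\<close>

context prob_space
begin

lemma indep_set_mono:
  assumes "indep_set A B" "B' \<subseteq> B" "A' \<subseteq> A"
  shows "indep_set A' B'"
  using assms(1) unfolding indep_set_def
  by (rule indep_sets_mono_sets) (use assms in \<open>auto split: bool.split\<close>)

text \<open>A sigma-algebra \<open>F\<close> independent of \<open>Z\<close> is treated through the identity map into \<open>F\<close>: the sample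
  point seen by \<open>F\<close> and the value of \<open>Z\<close> have a product law. Independence is expressed by families
  of events because \<open>indep_var\<close> requires two variables with values in the same type.\<close>

lemma distr_pair_indep:
  assumes sub: "subalgebra M F" and Z: "Z \<in> M \<rightarrow>\<^sub>M N"
    and ind: "indep_set (sets F) {Z -` B \<inter> space M | B. B \<in> sets N}"
  shows "distr M (F \<Otimes>\<^sub>M N) (\<lambda>\<omega>. (\<omega>, Z \<omega>)) = distr M F (\<lambda>\<omega>. \<omega>) \<Otimes>\<^sub>M distr M N Z"
proof -
  have F: "(\<lambda>\<omega>. \<omega>) \<in> M \<rightarrow>\<^sub>M F"
    by (rule measurable_from_subalg[OF sub measurable_ident_sets[OF refl]])
  have FZ: "(\<lambda>\<omega>. (\<omega>, Z \<omega>)) \<in> M \<rightarrow>\<^sub>M F \<Otimes>\<^sub>M N" using F Z by measurable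
  interpret P: prob_space "distr M F (\<lambda>\<omega>. \<omega>)" by (rule prob_space_distr[OF F])
  interpret Q: prob_space "distr M N Z" by (rule prob_space_distr[OF Z])
  show ?thesis
  proof (rule pair_measure_eqI[symmetric])
    fix A B
    assume "A \<in> sets (distr M F (\<lambda>\<omega>. \<omega>))" "B \<in> sets (distr M N Z)"
    then have A: "A \<in> sets F" and B: "B \<in> sets N" by auto
    have sp: "A \<inter> space M = A" and "A \<in> events"
      using A sub sets.sets_into_space[OF A] by (auto simp: subalgebra_def)
    have "(\<lambda>\<omega>. (\<omega>, Z \<omega>)) -` (A \<times> B) \<inter> space M = A \<inter> (Z -` B \<inter> space M)"
      using sp by auto
    moreover have "prob (A \<inter> (Z -` B \<inter> space M)) = prob A * prob (Z -` B \<inter> space M)"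
      using ind A B unfolding indep_sets2_eq by blast
    ultimately show "emeasure (distr M F (\<lambda>\<omega>. \<omega>)) A * emeasure (distr M N Z) B =
        emeasure (distr M (F \<Otimes>\<^sub>M N) (\<lambda>\<omega>. (\<omega>, Z \<omega>))) (A \<times> B)"
      using A B F FZ Z sp by (simp add: emeasure_distr emeasure_eq_measure ennreal_mult)
  qed (simp_all add: P.sigma_finite_measure_axioms Q.sigma_finite_measure_axioms cong: sets_pair_measure_cong)
qed

text \<open>The freezing lemma: given \<open>F\<close>, the \<open>F\<close>-measurable argument of \<open>f\<close> is held fixed and the
  independent one is averaged out. Measurability of \<open>f\<close> is with respect to \<open>F\<close> in the first
  argument.\<close>

lemma real_cond_exp_indep:
  fixes f :: "'a \<Rightarrow> 'b \<Rightarrow> real"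
  assumes sub: "subalgebra M F" and Z: "Z \<in> M \<rightarrow>\<^sub>M N"
    and ind: "indep_set (sets F) {Z -` B \<inter> space M | B. B \<in> sets N}"
    and f [measurable]: "case_prod f \<in> borel_measurable (F \<Otimes>\<^sub>M N)"
    and int: "integrable M (\<lambda>\<omega>. f \<omega> (Z \<omega>))"
  shows "AE \<omega> in M. real_cond_exp M F (\<lambda>\<omega>. f \<omega> (Z \<omega>)) \<omega> = (\<integral>z. f \<omega> z \<partial>distr M N Z)"
proof -
  define P where "P = distr M F (\<lambda>\<omega>. \<omega>)"
  define Q where "Q = distr M N Z"
  have F: "(\<lambda>\<omega>. \<omega>) \<in> M \<rightarrow>\<^sub>M F"
    by (rule measurable_from_subalg[OF sub measurable_ident_sets[OF refl]])
  have FZ: "(\<lambda>\<omega>. (\<omega>, Z \<omega>)) \<in> M \<rightarrow>\<^sub>M F \<Otimes>\<^sub>M N" using F Z by measurable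
  interpret P: prob_space P unfolding P_def by (rule prob_space_distr[OF F])
  interpret Q: prob_space Q unfolding Q_def by (rule prob_space_distr[OF Z])
  interpret PQ: pair_sigma_finite P Q ..
  have [measurable_cong]: "sets P = sets F" "sets Q = sets N" by (auto simp: P_def Q_def)
  have PQ: "distr M (F \<Otimes>\<^sub>M N) (\<lambda>\<omega>. (\<omega>, Z \<omega>)) = P \<Otimes>\<^sub>M Q"
    unfolding P_def Q_def by (rule distr_pair_indep[OF sub Z ind])
  define g where "g \<omega> = (\<integral>z. f \<omega> z \<partial>Q)" for \<omega>
  have g [measurable]: "g \<in> borel_measurable F" unfolding g_def by measurable
  have f_int: "integrable (P \<Otimes>\<^sub>M Q) (case_prod f)"
    unfolding PQ[symmetric] using int by (subst integrable_distr_eq[OF FZ f]) simp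
  have "integrable P g" using PQ.integrable_fst'[OF f_int] by (simp add: g_def[abs_def])
  then have g_int: "integrable M g" unfolding P_def by (subst (asm) integrable_distr_eq[OF F g])
  interpret fms: finite_measure_subalgebra M F using sub by unfold_locales
  have "AE \<omega> in M. real_cond_exp M F (\<lambda>\<omega>. f \<omega> (Z \<omega>)) \<omega> = g \<omega>"
  proof (rule fms.real_cond_exp_charact[OF _ int g_int g])
    fix A assume A [measurable]: "A \<in> sets F"
    define fA where "fA \<omega> z = indicator A \<omega> * f \<omega> z" for \<omega> z
    have fA [measurable]: "case_prod fA \<in> borel_measurable (F \<Otimes>\<^sub>M N)" unfolding fA_def by measurable
    have "A \<in> sets M" using sub A by (auto simp: subalgebra_def)
    then have "integrable M (\<lambda>\<omega>. fA \<omega> (Z \<omega>))"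
      unfolding fA_def using integrable_mult_indicator[OF _ int] by simp
    then have fA_int: "integrable (P \<Otimes>\<^sub>M Q) (case_prod fA)"
      unfolding PQ[symmetric] by (subst integrable_distr_eq[OF FZ fA]) simp
    have "(\<integral>\<omega>\<in>A. f \<omega> (Z \<omega>) \<partial>M) = (\<integral>p. case_prod fA p \<partial>(P \<Otimes>\<^sub>M Q))"
      unfolding PQ[symmetric] by (subst integral_distr[OF FZ fA]) (simp add: fA_def set_lebesgue_integral_def)
    also have "\<dots> = (\<integral>\<omega>. (\<integral>z. fA \<omega> z \<partial>Q) \<partial>P)"
      using PQ.integral_fst'[OF fA_int] by simp
    also have "\<dots> = (\<integral>\<omega>. indicator A \<omega> * g \<omega> \<partial>P)"
      by (simp add: fA_def g_def)
    also have "\<dots> = (\<integral>\<omega>\<in>A. g \<omega> \<partial>M)"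
      unfolding P_def by (subst integral_distr[OF F]) (auto simp: set_lebesgue_integral_def)
    finally show "(\<integral>\<omega>\<in>A. f \<omega> (Z \<omega>) \<partial>M) = (\<integral>\<omega>\<in>A. g \<omega> \<partial>M)" .
  qed
  then show ?thesis unfolding g_def Q_def .
qed

lemma nn_integral_indep:
  assumes sub: "subalgebra M F" and Z: "Z \<in> M \<rightarrow>\<^sub>M N"
    and ind: "indep_set (sets F) {Z -` B \<inter> space M | B. B \<in> sets N}"
    and f [measurable]: "case_prod f \<in> borel_measurable (F \<Otimes>\<^sub>M N)"
  shows "(\<integral>\<^sup>+\<omega>. f \<omega> (Z \<omega>) \<partial>M) = (\<integral>\<^sup>+\<omega>. (\<integral>\<^sup>+z. f \<omega> z \<partial>distr M N Z) \<partial>M)"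
proof -
  have F: "(\<lambda>\<omega>. \<omega>) \<in> M \<rightarrow>\<^sub>M F"
    by (rule measurable_from_subalg[OF sub measurable_ident_sets[OF refl]])
  have FZ: "(\<lambda>\<omega>. (\<omega>, Z \<omega>)) \<in> M \<rightarrow>\<^sub>M F \<Otimes>\<^sub>M N" using F Z by measurable
  interpret Q: prob_space "distr M N Z" by (rule prob_space_distr[OF Z])
  have "(\<integral>\<^sup>+\<omega>. f \<omega> (Z \<omega>) \<partial>M) = (\<integral>\<^sup>+p. case_prod f p \<partial>(distr M F (\<lambda>\<omega>. \<omega>) \<Otimes>\<^sub>M distr M N Z))"
    unfolding distr_pair_indep[OF sub Z ind, symmetric] by (subst nn_integral_distr[OF FZ]) auto
  also have "\<dots> = (\<integral>\<^sup>+\<omega>. (\<integral>\<^sup>+z. f \<omega> z \<partial>distr M N Z) \<partial>distr M F (\<lambda>\<omega>. \<omega>))"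
    by (subst Q.nn_integral_fst[symmetric]) auto
  also have "\<dots> = (\<integral>\<^sup>+\<omega>. (\<integral>\<^sup>+z. f \<omega> z \<partial>distr M N Z) \<partial>M)"
    by (rule nn_integral_distr[OF F]) measurable
  finally show ?thesis .
qed

lemma AR1_past_indep:
  assumes "indep_vars (\<lambda>_. borel) \<eta> {1..}"
  shows "indep_set (sets (nat_filtration M (AR1 lam x \<eta>) n)) {\<eta> (Suc n) -` B \<inter> space M | B. B \<in> sets borel}"
proof -
  \<comment> \<open>\<open>V\<close> is the sigma-algebra of the first \<open>n\<close> innovations; it contains the past of the process\<close>
  define T where "T \<omega> = restrict (\<lambda>i. \<eta> i \<omega>) {1..n}" for \<omega>
  define V where "V = vimage_algebra (space M) T (PiM {1..n} (\<lambda>_. borel :: real measure))"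
  have "indep_var (PiM {1..n} (\<lambda>_. borel)) T
     (PiM {Suc n} (\<lambda>_. borel)) (\<lambda>\<omega>. restrict (\<lambda>i. \<eta> i \<omega>) {Suc n})"
    unfolding T_def by (rule indep_var_restrict[OF assms]) auto
  then have "indep_set (sets V) (sigma_sets (space M)
      {(\<lambda>\<omega>. restrict (\<lambda>i. \<eta> i \<omega>) {Suc n}) -` B \<inter> space M | B. B \<in> sets (PiM {Suc n} (\<lambda>_. borel))})"
    unfolding indep_var_eq V_def sets_vimage_algebra by blast
  moreover have "{\<eta> (Suc n) -` B \<inter> space M | B. B \<in> sets borel} \<subseteq> sigma_sets (space M)
      {(\<lambda>\<omega>. restrict (\<lambda>i. \<eta> i \<omega>) {Suc n}) -` B \<inter> space M | B. B \<in> sets (PiM {Suc n} (\<lambda>_. borel))}"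
  proof safe
    fix B :: "real set"
    assume "B \<in> sets borel"
    then have "(\<lambda>t. t (Suc n)) -` B \<inter> space (PiM {Suc n} (\<lambda>_. borel)) \<in> sets (PiM {Suc n} (\<lambda>_. borel))"
      by (intro measurable_sets[OF measurable_component_singleton]) auto
    moreover have "\<eta> (Suc n) -` B \<inter> space M = (\<lambda>\<omega>. restrict (\<lambda>i. \<eta> i \<omega>) {Suc n}) -`
        ((\<lambda>t. t (Suc n)) -` B \<inter> space (PiM {Suc n} (\<lambda>_. borel))) \<inter> space M"
      by (auto simp: space_PiM)
    ultimately show "\<eta> (Suc n) -` B \<inter> space M \<in> sigma_sets (space M)
      {(\<lambda>\<omega>. restrict (\<lambda>i. \<eta> i \<omega>) {Suc n}) -` B \<inter> space M | B. B \<in> sets (PiM {Suc n} (\<lambda>_. borel))}"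
      by (intro sigma_sets.Basic) blast
  qed
  moreover have "sets (nat_filtration M (AR1 lam x \<eta>) n) \<subseteq> sets V"
  proof (rule nat_filtration_subset)
    have T: "T \<in> V \<rightarrow>\<^sub>M PiM {1..n} (\<lambda>_. borel)"
      unfolding V_def T_def by (rule measurable_vimage_algebra1) (auto simp: space_PiM)
    have "\<eta> i \<in> borel_measurable V" if "1 \<le> i" "i \<le> n" for i
      using measurable_compose[OF T measurable_component_singleton[of i "{1..n}"]] that
      by (simp add: T_def)
    then show "AR1 lam x \<eta> i \<in> borel_measurable V" if "i \<le> n" for i
      using that by (intro AR1_measurable) auto
  qed (simp add: V_def)
  ultimately show ?thesis by (rule indep_set_mono)
qed

text \<open>By the tower property, the martingale identity need only be checked for consecutive times.\<close>

lemma martingaleI_step: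
  assumes "filtration (space M) F" "\<And>n. subalgebra M (F n)"
    and "\<And>n. Y n \<in> borel_measurable (F n)" and int: "\<And>n. integrable M (Y n)"
    and step: "\<And>n. AE \<omega> in M. real_cond_exp M (F n) (Y (Suc n)) \<omega> = Y n \<omega>"
  shows "martingale M F Y"
  unfolding martingale_def
proof (intro conjI allI impI)
  fix k n :: nat
  assume "k \<le> n"
  then show "AE \<omega> in M. real_cond_exp M (F k) (Y n) \<omega> = Y k \<omega>"
  proof (induction n rule: dec_induct)
    case base
    interpret finite_measure_subalgebra M "F k" using assms(2) by unfold_locales
    show ?case by (rule real_cond_exp_F_meas[OF int assms(3)])
  next
    case (step n)
    interpret finite_measure_subalgebra M "F k" using assms(2) by unfold_locales
    interpret n: finite_measure_subalgebra M "F n" using assms(2) by unfold_locales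
    have "subalgebra (F n) (F k)"
      using assms(1) step(1) by (auto simp: subalgebra_def filtration_def)
    then have "AE \<omega> in M. real_cond_exp M (F k) (real_cond_exp M (F n) (Y (Suc n))) \<omega> = real_cond_exp M (F k) (Y (Suc n)) \<omega>"
      by (rule real_cond_exp_nested_subalg[OF assms(2) _ int])
    moreover have "AE \<omega> in M. real_cond_exp M (F k) (real_cond_exp M (F n) (Y (Suc n))) \<omega> = real_cond_exp M (F k) (Y n) \<omega>"
      using assms(5)[of n] by (rule real_cond_exp_cong) (use int in auto)
    ultimately show ?case using step.IH by eventually_elim simp
  qed
qed (rule assms)+

end


section \<open>The martingale property\<close>

theorem proposition3:
  fixes M :: "'a measure" and \<eta> :: "nat \<Rightarrow> 'a \<Rightarrow> real"
    and lam x v \<delta> :: real and D :: "real set"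
  defines "X \<equiv> AR1 lam x \<eta>"
    and "\<phi> \<equiv> cumulant_sum M lam (\<eta> 1)"
  assumes "prob_space M"
    and "iid_seq M \<eta>"
    and "0 < lam" and "lam < 1"
    and "x \<in> D" and "\<And>n. AE \<omega> in M. X n \<omega> \<in> D"
    and "v < 0"
    and "\<And>u. u \<ge> 0 \<Longrightarrow> integrable M (\<lambda>\<omega>. exp (u * \<eta> 1 \<omega>))"
    and "\<And>y. y \<in> D \<Longrightarrow> set_integrable lborel {1..} (\<lambda>u. exp (u * y - \<phi> u) * u powr (v - 1))"
    and "0 < \<delta>" and "\<delta> \<le> 1"
    and "integrable M (\<lambda>\<omega>. max (- \<eta> 1 \<omega>) 0 powr \<delta>)"
    and "- \<delta> < v"
  shows "(\<forall>y\<in>D. set_integrable lborel {0<..} (W_integrand \<phi> v y)) \<and>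
         martingale M (nat_filtration M X) (\<lambda>n \<omega>. lam powr (v * real n) * W \<phi> v (X n \<omega>))"
proof -
  interpret prob_space M by fact
  have indep: "indep_vars (\<lambda>_. borel) \<eta> {1..}"
    and law: "\<And>n. 1 \<le> n \<Longrightarrow> distr M borel (\<eta> n) = distr M borel (\<eta> 1)"
    using \<open>iid_seq M \<eta>\<close> unfolding iid_seq_def by blast+
  have eta [measurable]: "\<eta> n \<in> borel_measurable M" if "1 \<le> n" for n
    using indep that by (auto simp: indep_vars_def)
  note eta1 [measurable] = eta[of 1, simplified]
  define \<nu> where "\<nu> = distr M borel (\<eta> 1)"
  interpret \<nu>: prob_space \<nu> unfolding \<nu>_def by (rule prob_space_distr) simp
  interpret \<nu>: ar1_noise \<nu> lam v \<delta>
  proof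
    show "integrable \<nu> (\<lambda>z. exp (u * z))" if "0 \<le> u" for u
      unfolding \<nu>_def using assms(10)[OF that] by (subst integrable_distr_eq) auto
    show "integrable \<nu> (\<lambda>z. max (- z) 0 powr \<delta>)"
      unfolding \<nu>_def using assms(14) by (subst integrable_distr_eq) auto
    show "sets \<nu> = sets borel" by (simp add: \<nu>_def)
  qed fact+
  have cumulant_eq: "cumulant M (\<eta> 1) u = cumulant \<nu> (\<lambda>z. z) u" for u
    unfolding cumulant_def \<nu>_def by (subst integral_distr) auto
  have phi_eq: "\<phi> = cumulant_sum \<nu> lam (\<lambda>z. z)"
    unfolding \<phi>_def cumulant_sum_def[abs_def] cumulant_eq ..
  have G_D: "\<nu>.G y < \<infinity>" if "y \<in> D" for y
    unfolding \<nu>.integrable_h_iff[symmetric]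
    using \<nu>.h_integrable assms(11)[OF that] by (simp add: phi_eq)
  have W_int: "set_integrable lborel {0<..} (W_integrand \<phi> v y)" if "y \<in> D" for y
    using G_D[OF that] unfolding \<nu>.integrable_h_iff[symmetric] \<nu>.h_def[abs_def]
    by (simp add: set_integrable_def phi_eq)

  define F where "F = nat_filtration M X"
  have X_meas [measurable]: "X n \<in> borel_measurable M" for n
    unfolding X_def by (rule AR1_measurable) (rule eta)
  have X_F: "X n \<in> borel_measurable (F n)" for n
    unfolding F_def by (rule measurable_nat_filtration) simp
  have sub: "subalgebra M (F n)" for n
    unfolding F_def by (rule subalgebra_nat_filtration) measurable
  have ind: "indep_set (sets (F n)) {\<eta> (Suc n) -` B \<inter> space M | B. B \<in> sets borel}" for n
    unfolding F_def X_def by (rule AR1_past_indep[OF indep])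
  have X_Suc: "X (Suc n) = (\<lambda>\<omega>. lam * X n \<omega> + \<eta> (Suc n) \<omega>)" for n
    by (simp add: X_def fun_eq_iff)
  have law': "distr M borel (\<eta> (Suc n)) = \<nu>" for n
    unfolding \<nu>_def by (rule law) simp
  have eta_Suc: "\<eta> (Suc n) \<in> borel_measurable M" for n by (rule eta) simp

  \<comment> \<open>integrability along the trajectory, by iterating the one-step bound from the initial state\<close>
  have G_X: "(\<integral>\<^sup>+\<omega>. \<nu>.G (X n \<omega>) \<partial>M) < \<infinity>" for n
  proof (induction n)
    case 0
    then show ?case using G_D[OF \<open>x \<in> D\<close>] by (simp add: X_def emeasure_space_1)
  next
    case (Suc n)
    note [measurable] = X_F[of n]
    have "(\<integral>\<^sup>+\<omega>. \<nu>.G (X (Suc n) \<omega>) \<partial>M) = (\<integral>\<^sup>+\<omega>. (\<integral>\<^sup>+z. \<nu>.G (lam * X n \<omega> + z) \<partial>\<nu>) \<partial>M)"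
      unfolding X_Suc
      by (subst nn_integral_indep[OF sub eta_Suc ind, of "\<lambda>\<omega> z. \<nu>.G (lam * X n \<omega> + z)" n]) (auto simp: law')
    also have "\<dots> \<le> (\<integral>\<^sup>+\<omega>. ennreal (lam powr (- v)) * \<nu>.G (X n \<omega>) + \<nu>.A \<partial>M)"
      by (intro nn_integral_mono \<nu>.G_step)
    also have "\<dots> = ennreal (lam powr (- v)) * (\<integral>\<^sup>+\<omega>. \<nu>.G (X n \<omega>) \<partial>M) + \<nu>.A"
      by (simp add: nn_integral_add nn_integral_cmult emeasure_space_1)
    also have "\<dots> < \<infinity>"
      using Suc \<nu>.A_finite by (simp add: ennreal_mult_less_top)
    finally show ?case .
  qed
  have W_meas [measurable]: "W \<phi> v \<in> borel_measurable borel"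
    unfolding phi_eq by (rule \<nu>.W_measurable)
  have W_X: "integrable M (\<lambda>\<omega>. W \<phi> v (X n \<omega>))" for n
  proof (subst integrable_iff_bounded, intro conjI)
    have "(\<integral>\<^sup>+\<omega>. ennreal (norm (W \<phi> v (X n \<omega>))) \<partial>M) \<le> (\<integral>\<^sup>+\<omega>. \<nu>.G (X n \<omega>) \<partial>M)"
      unfolding phi_eq by (intro nn_integral_mono) (simp add: \<nu>.abs_W_le)
    then show "(\<integral>\<^sup>+\<omega>. ennreal (norm (W \<phi> v (X n \<omega>))) \<partial>M) < \<infinity>"
      using G_X[of n] by (rule order.strict_trans1)
  qed measurable

  have "martingale M F (\<lambda>n \<omega>. lam powr (v * real n) * W \<phi> v (X n \<omega>))"
  proof (rule martingaleI_step)
    show "filtration (space M) F" unfolding F_def by (rule filtration_nat_filtration)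
    show "subalgebra M (F n)" for n by (rule sub)
    show "(\<lambda>\<omega>. lam powr (v * real n) * W \<phi> v (X n \<omega>)) \<in> borel_measurable (F n)" for n
      using X_F[of n] by measurable
    show "integrable M (\<lambda>\<omega>. lam powr (v * real n) * W \<phi> v (X n \<omega>))" for n
      using W_X by simp
    fix n
    note [measurable] = X_F[of n]
    interpret fms: finite_measure_subalgebra M "F n" using sub by unfold_locales
    \<comment> \<open>\<open>W_step\<close> applies at almost every value of \<open>X n\<close>\<close>
    have G_fin: "AE \<omega> in M. \<nu>.G (X n \<omega>) \<noteq> \<infinity>"
      using G_X[of n] by (intro nn_integral_PInf_AE) auto
    have "AE \<omega> in M. real_cond_exp M (F n) (\<lambda>\<omega>. W \<phi> v (X (Suc n) \<omega>)) \<omega> = (\<integral>z. W \<phi> v (lam * X n \<omega> + z) \<partial>\<nu>)"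
      using real_cond_exp_indep[OF sub eta_Suc ind, of "\<lambda>\<omega> z. W \<phi> v (lam * X n \<omega> + z)" n] W_X[of "Suc n"]
      by (simp add: X_Suc law')
    moreover have "AE \<omega> in M. real_cond_exp M (F n) (\<lambda>\<omega>. lam powr (v * real (Suc n)) * W \<phi> v (X (Suc n) \<omega>)) \<omega>
        = lam powr (v * real (Suc n)) * real_cond_exp M (F n) (\<lambda>\<omega>. W \<phi> v (X (Suc n) \<omega>)) \<omega>"
      by (rule fms.real_cond_exp_cmult[OF W_X])
    ultimately show "AE \<omega> in M. real_cond_exp M (F n) (\<lambda>\<omega>. lam powr (v * real (Suc n)) * W \<phi> v (X (Suc n) \<omega>)) \<omega>
        = lam powr (v * real n) * W \<phi> v (X n \<omega>)"
      using G_fin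
    proof eventually_elim
      case (elim \<omega>)
      then have "(\<integral>z. W \<phi> v (lam * X n \<omega> + z) \<partial>\<nu>) = lam powr (- v) * W \<phi> v (X n \<omega>)"
        unfolding phi_eq by (intro \<nu>.W_step) (simp add: less_top)
      moreover have "lam powr (v * real (Suc n)) * lam powr (- v) = lam powr (v * real n)"
        by (simp add: algebra_simps flip: powr_add)
      ultimately show ?case using elim by (simp flip: mult.assoc)
    qed
  qed
  with W_int show ?thesis by (simp add: F_def)
qed

end
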